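(* Let $\{R_i\}_{i=0}^\infty$ and $\{T_i\}_{i=0}^\infty$ be increasing sequences of commutative rings with identity (that is, $R_i$ is a subring of $R_{i+1}$ and $T_i$ is a subring of $T_{i+1}$ for every $i\ge 0$) such that $R_i$ is a subring of $T_i$ for each $i\ge 0$, all these rings sharing the same identity element. Let $S=R_0\cap U(T_0)$, and assume that for each $i\geq 1$, $\mathrm{Nil}(T_i)=S^{-1}\mathrm{Nil}(R_i)$ (in particular, this holds when each $T_i$ is reduced). Then $R_{\mathbb{N}_0}[x]$ is an associated subring of $T_{\mathbb{N}_0}[x]$ if and only if the following conditions both hold: (1) $R_0$ is an associated subring of $T_0$; (2) $T_i=S^{-1}R_i$ for each $i\geq 1$.
   Context: $U(A)$ denotes the group of units of a commutative ring $A$ with identity, and $\mathrm{Nil}(A)$ the set of nilpotent elements of $A$. For a subset $X\subseteq T_i$, $S^{-1}X=\{s^{-1}r : r\in X, s\in S\}\subseteq T_i$, where the inverses are taken in $T_0\subseteq T_i$. For an increasing sequence of commutative rings $\{A_i\}_{i=0}^\infty$ with union $A$, $A_{\mathbb{N}_0}[x]$ denotes the subring of $A[x]$ consisting of all polynomials whose coefficient of $x^i$ lies in $A_i$ for every $i\ge 0$. A subring $R$ of a commutative ring $T$ with identity is an associated subring of $T$ if for every $t\in T$ there exists $u\in U(T)$ such that $tu\in R$ (equivalently $T=R\cdot U(T)$). *)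

theory Defs
  imports "HOL-Algebra.UnivPoly" "HOL-Algebra.Subrings"
begin

text \<open>
  All rings of the two sequences live inside one commutative ring \<open>A\<close> (for instance the union of
  the larger sequence), so that a ring of a sequence is the structure
  \<open>A\<lparr>carrier := K\<rparr>\<close> for a subset \<open>K\<close> satisfying \<^term>\<open>subring K A\<close>.
\<close>

definition nilpotents :: "('a, 'm) ring_scheme \<Rightarrow> 'a set" where
  "nilpotents A = {a \<in> carrier A. \<exists>n::nat. 0 < n \<and> a [^]\<^bsub>A\<^esub> n = \<zero>\<^bsub>A\<^esub>}"

definition reduced_ring :: "('a, 'm) ring_scheme \<Rightarrow> bool" where
  "reduced_ring A \<longleftrightarrow> nilpotents A = {\<zero>\<^bsub>A\<^esub>}"

text \<open>\<open>S\<^sup>-\<^sup>1M\<close>, where inverses are taken in the subring with carrier \<open>K\<close> of \<open>A\<close>;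
  meaningful for \<open>S\<close> contained in the units of that subring.\<close>

definition fractions_in :: "('a, 'm) ring_scheme \<Rightarrow> 'a set \<Rightarrow> 'a set \<Rightarrow> 'a set \<Rightarrow> 'a set" where
  "fractions_in A K S M = {inv\<^bsub>A\<lparr>carrier := K\<rparr>\<^esub> s \<otimes>\<^bsub>A\<^esub> r | s r. s \<in> S \<and> r \<in> M}"

definition associated_subring :: "'a set \<Rightarrow> ('a, 'm) ring_scheme \<Rightarrow> bool" where
  "associated_subring R T \<longleftrightarrow>
     subring R T \<and> (\<forall>t \<in> carrier T. \<exists>u \<in> Units T. t \<otimes>\<^bsub>T\<^esub> u \<in> R)"

text \<open>The carrier of \<open>K\<^bsub>\<nat>\<^sub>0\<^esub>[x]\<close>, for an increasing sequence of subrings \<open>K i\<close> of \<open>A\<close>. Such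
  polynomials automatically have coefficients in the union of the \<open>K i\<close>, so this does not depend
  on how large \<open>A\<close> is.\<close>

definition seq_poly :: "('a, 'm) ring_scheme \<Rightarrow> (nat \<Rightarrow> 'a set) \<Rightarrow> (nat \<Rightarrow> 'a) set" where
  "seq_poly A K = {p \<in> carrier (UP A). \<forall>i. coeff (UP A) p i \<in> K i}"

definition seq_poly_ring :: "('a, 'm) ring_scheme \<Rightarrow> (nat \<Rightarrow> 'a set) \<Rightarrow> ('a, nat \<Rightarrow> 'a) up_ring" where
  "seq_poly_ring A K = (UP A)\<lparr>carrier := seq_poly A K\<rparr>"

end

theory Submission
  imports Defs
begin

text \<open>Write \<open>R[x]\<close> and \<open>T[x]\<close> for the rings of polynomials whose coefficient of degree \<open>i\<close> lies in \<open>R\<^sub>i\<close>,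
  respectively in \<open>T\<^sub>i\<close>. The theorem holds because a unit \<open>u\<close> of \<open>T[x]\<close> is, up to nilpotent coefficients, a
  constant: \<open>u\<^sub>0\<close> is a unit of \<open>T\<^sub>0\<close>, and every other \<open>u\<^sub>i\<close> is nilpotent
  (\<open>nilpotent_coeff_of_unit\<close>).

  Suppose that \<open>R[x]\<close> is associated in \<open>T[x]\<close>. Multiplying a constant \<open>t \<in> T\<^sub>0\<close> by a suitable unit \<open>u\<close> and
  comparing constant coefficients gives \<open>t u\<^sub>0 \<in> R\<^sub>0\<close>, so \<open>R\<^sub>0\<close> is associated in \<open>T\<^sub>0\<close>. For \<open>t \<in> T\<^sub>i\<close> with
  \<open>i > 0\<close>, let \<open>u\<close> be a unit with \<open>(1 + t x\<^sup>i) u \<in> R[x]\<close>. Then \<open>u\<^sub>0 \<in> R\<^sub>0\<close>, hence \<open>u\<^sub>0 \<in> S\<close>, and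
  \<open>u\<^sub>i + t u\<^sub>0 \<in> R\<^sub>i\<close>. As \<open>u\<^sub>i\<close> is nilpotent, the hypothesis on nilradicals gives \<open>s \<in> S\<close> with
  \<open>s u\<^sub>i \<in> R\<^sub>i\<close>; therefore \<open>s u\<^sub>0 t \<in> R\<^sub>i\<close>, and \<open>t \<in> S\<^sup>-\<^sup>1R\<^sub>i\<close>
  (\<open>denominator_if_associated_seq_poly\<close>).

  Conversely, under the two conditions any \<open>f \<in> T[x]\<close> is moved into \<open>R[x]\<close> by a constant unit, obtained
  by clearing the finitely many denominators of its coefficients (\<open>associated_seq_poly_if\<close>).

  When \<open>T\<^sub>i\<close> is reduced, both sides of the hypothesis on nilradicals are \<open>{0}\<close>.\<close>

section \<open>The nilradical\<close>

lemma nilpotentsI: "a \<in> carrier A \<Longrightarrow> 0 < (n::nat) \<Longrightarrow> a [^]\<^bsub>A\<^esub> n = \<zero>\<^bsub>A\<^esub> \<Longrightarrow> a \<in> nilpotents A"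
  unfolding nilpotents_def by blast

lemma nilpotents_subring:
  assumes "K \<subseteq> carrier A"
  shows "nilpotents (A\<lparr>carrier := K\<rparr>) = nilpotents A \<inter> K"
  using assms unfolding nilpotents_def by (auto simp: monoid.nat_pow_consistent nat_pow_def)

context cring
begin

lemma zero_nilpotent: "\<zero> \<in> nilpotents R"
  by (rule nilpotentsI[of _ _ 1]) auto

lemma nilpotent_mult:
  assumes "c \<in> carrier R" "a \<in> nilpotents R"
  shows "c \<otimes> a \<in> nilpotents R"
proof -
  obtain n :: nat where n: "0 < n" "a [^] n = \<zero>" and a: "a \<in> carrier R"
    using assms(2) unfolding nilpotents_def by blast
  have "(c \<otimes> a) [^] n = c [^] n \<otimes> a [^] n"
    using assms(1) a by (simp add: nat_pow_distrib)
  then show ?thesis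
    using n a assms(1) by (intro nilpotentsI[of _ _ n]) auto
qed

lemma nilpotent_of_square:
  assumes "a \<in> carrier R" "a \<otimes> a \<in> nilpotents R"
  shows "a \<in> nilpotents R"
proof -
  obtain n :: nat where n: "0 < n" "(a \<otimes> a) [^] n = \<zero>"
    using assms(2) unfolding nilpotents_def by blast
  have "a [^] (n + n) = (a \<otimes> a) [^] n"
    using assms(1) by (simp add: nat_pow_distrib nat_pow_mult)
  then show ?thesis
    using n assms(1) by (intro nilpotentsI[of _ _ "n + n"]) auto
qed

text \<open>Each expansion of one factor \<open>a \<oplus> b\<close> raises the exponent of \<open>a\<close> or that of \<open>b\<close>; so the three
  exponents keep their sum, and no binomial coefficient appears.\<close>

lemma mult_sum_power_eq_zero:
  assumes a: "a \<in> carrier R" "a [^] (m::nat) = \<zero>" and b: "b \<in> carrier R" "b [^] (n::nat) = \<zero>"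
    and "m + n \<le> i + j + k"
  shows "a [^] i \<otimes> b [^] j \<otimes> (a \<oplus> b) [^] k = \<zero>"
  using assms(5)
proof (induction k arbitrary: i j)
  case 0
  show ?case
  proof (cases "m \<le> i")
    case True
    then have "a [^] i = a [^] m \<otimes> a [^] (i - m)"
      using a(1) by (simp add: nat_pow_mult)
    then show ?thesis using a b by simp
  next
    case False
    then have "b [^] j = b [^] n \<otimes> b [^] (j - n)"
      using 0 b(1) by (simp add: nat_pow_mult)
    then show ?thesis using a b by simp
  qed
next
  case (Suc k)
  let ?c = "(a \<oplus> b) [^] k"
  have "a [^] i \<otimes> b [^] j \<otimes> (a \<oplus> b) [^] Suc k =
      a [^] Suc i \<otimes> b [^] j \<otimes> ?c \<oplus> a [^] i \<otimes> b [^] Suc j \<otimes> ?c"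
    using a(1) b(1) by (simp add: l_distr r_distr m_ac)
  also have "\<dots> = \<zero>"
    using Suc.IH[of "Suc i" j] Suc.IH[of i "Suc j"] Suc.prems by simp
  finally show ?case .
qed

lemma nilpotent_add:
  assumes "a \<in> nilpotents R" "b \<in> nilpotents R"
  shows "a \<oplus> b \<in> nilpotents R"
proof -
  obtain m n :: nat where "0 < m" "a [^] m = \<zero>" "b [^] n = \<zero>" "a \<in> carrier R" "b \<in> carrier R"
    using assms unfolding nilpotents_def by blast
  then show ?thesis
    using mult_sum_power_eq_zero[of a m b n 0 0 "m + n"]
    by (intro nilpotentsI[of _ _ "m + n"]) auto
qed

lemma nilpotent_finsum:
  assumes "finite I" "\<And>i. i \<in> I \<Longrightarrow> f i \<in> nilpotents R"
  shows "(\<Oplus>i\<in>I. f i) \<in> nilpotents R"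
  using assms
proof (induction I rule: finite_induct)
  case empty
  then show ?case by (simp add: zero_nilpotent)
next
  case (insert i I)
  have "f \<in> insert i I \<rightarrow> carrier R"
    using insert.prems unfolding nilpotents_def by blast
  then show ?case
    using insert nilpotent_add by (simp add: Pi_def)
qed

end

section \<open>Units of polynomial rings\<close>

text \<open>Modulo the nilradical the coefficients of \<open>f\<close> and \<open>g\<close> behave as in a reduced ring. If \<open>a\<^sub>n\<close> is the
  last coefficient of \<open>f\<close> that could fail to be nilpotent and \<open>n > 0\<close>, then comparing the coefficients of
  degree \<open>n + j\<close> in \<open>f g = 1\<close>, for decreasing \<open>j\<close>, shows that \<open>a\<^sub>n\<close> annihilates every coefficient of \<open>g\<close>
  up to nilpotents. One of these, the constant one, is a unit.\<close>

lemma (in UP_cring) nilpotent_coeff_of_unit: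
  assumes f: "f \<in> carrier P" and g: "g \<in> carrier P" and fg: "f \<otimes>\<^bsub>P\<^esub> g = \<one>\<^bsub>P\<^esub>"
    and "0 < n"
  shows "coeff P f n \<in> nilpotents R"
  using \<open>0 < n\<close>
proof (induction "Suc (deg R f) - n" arbitrary: n rule: less_induct)
  case (less n)
  let ?a = "coeff P f" and ?b = "coeff P g"
  show ?case
  proof (cases "deg R f < n")
    case True
    then show ?thesis using f by (simp add: deg_aboveD R.zero_nilpotent)
  next
    case False
    then have above: "?a i \<in> nilpotents R" if "n < i" for i
      using less.hyps[of i] that less.prems by simp
    have step: "?a n \<otimes> ?b j \<in> nilpotents R" for j
    proof (induction "Suc (deg R g) - j" arbitrary: j rule: less_induct)
      case (less j)
      show ?case
      proof (cases "deg R g < j")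
        case True
        then show ?thesis using f g by (simp add: deg_aboveD R.zero_nilpotent)
      next
        case False
        then have b: "?a n \<otimes> ?b k \<in> nilpotents R" if "j < k" for k
          using less.hyps[of k] that by simp
        \<comment> \<open>\<open>c\<close> collects the terms of the coefficient of degree \<open>n + j\<close> other than \<open>a\<^sub>n b\<^sub>j\<close>; each becomes
          nilpotent after multiplication by \<open>a\<^sub>n\<close>, by \<open>above\<close> if \<open>i > n\<close> and by \<open>b\<close> if \<open>i < n\<close>\<close>
        define c where "c = (\<Oplus>i \<in> {..n + j} - {n}. ?a i \<otimes> ?b (n + j - i))"
        have c: "c \<in> carrier R"
          unfolding c_def using f g by (intro R.finsum_closed) auto
        have "\<zero> = (\<Oplus>i \<in> {..n + j}. ?a i \<otimes> ?b (n + j - i))"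
          using fg coeff_mult[OF f g, of "n + j"] \<open>0 < n\<close> by simp
        also have "{..n + j} = insert n ({..n + j} - {n})"
          by auto
        also have "(\<Oplus>i \<in> \<dots>. ?a i \<otimes> ?b (n + j - i)) = ?a n \<otimes> ?b j \<oplus> c"
          unfolding c_def using f g by (subst R.finsum_insert) auto
        finally have "?a n \<otimes> ?b j \<oplus> c = \<zero>" by simp
        then have eq: "?a n \<otimes> ?b j = \<ominus> c"
          using f g c by (simp add: R.minus_equality)
        have "?a n \<otimes> c = (\<Oplus>i \<in> {..n + j} - {n}. ?a n \<otimes> (?a i \<otimes> ?b (n + j - i)))"
          unfolding c_def using f g by (intro R.finsum_rdistr) auto
        also have "\<dots> \<in> nilpotents R"
        proof (rule R.nilpotent_finsum)
          fix i assume i: "i \<in> {..n + j} - {n}"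
          show "?a n \<otimes> (?a i \<otimes> ?b (n + j - i)) \<in> nilpotents R"
          proof (cases "n < i")
            case True
            have "?a n \<otimes> ?b (n + j - i) \<otimes> ?a i \<in> nilpotents R"
              using f g above[OF True] by (intro R.nilpotent_mult) auto
            then show ?thesis using f g by (simp add: R.m_ac)
          next
            case False
            then have "?a i \<otimes> (?a n \<otimes> ?b (n + j - i)) \<in> nilpotents R"
              using f i by (intro R.nilpotent_mult[OF _ b]) auto
            then show ?thesis using f g by (simp add: R.m_ac)
          qed
        qed simp
        finally have nil: "?a n \<otimes> c \<in> nilpotents R" .
        have "(?a n \<otimes> ?b j) \<otimes> (?a n \<otimes> ?b j) = (\<ominus> ?b j) \<otimes> (?a n \<otimes> c)"
          using f g c by (subst (2) eq) (simp add: R.l_minus R.r_minus R.m_ac)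
        then show ?thesis
          using R.nilpotent_mult[OF _ nil, of "\<ominus> ?b j"] f g
          by (simp add: R.nilpotent_of_square)
      qed
    qed
    have "?a 0 \<otimes> ?b 0 = \<one>"
      using coeff_mult[OF f g, of 0] fg f g by simp
    then have "?a 0 \<otimes> (?a n \<otimes> ?b 0) = ?a n"
      using f g by (metis R.m_lcomm R.r_one coeff_closed)
    then show ?thesis
      using R.nilpotent_mult[OF _ step, of "?a 0" 0] f by simp
  qed
qed

section \<open>Subrings, fractions and polynomials over a sequence of subrings\<close>

lemma (in ring) subring_of_subring:
  assumes "subring H R" "subring K R" "H \<subseteq> K"
  shows "subring H (R\<lparr>carrier := K\<rparr>)"
  using ring.subring_iff[OF subring_is_ring[OF assms(2)], of H] subring_is_ring[OF assms(1)] assms(3)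
  by simp

lemma (in cring) Units_subring_iff:
  assumes "subring K R"
  shows "u \<in> Units (R\<lparr>carrier := K\<rparr>) \<longleftrightarrow> u \<in> K \<and> (\<exists>v\<in>K. u \<otimes> v = \<one>)"
  using subringE(1)[OF assms] m_comm unfolding Units_def by (auto simp: subset_iff)

lemma (in cring) Units_subring_mult:
  assumes "subring K R" "u \<in> Units (R\<lparr>carrier := K\<rparr>)" "v \<in> Units (R\<lparr>carrier := K\<rparr>)"
  shows "u \<otimes> v \<in> Units (R\<lparr>carrier := K\<rparr>)"
  using monoid.Units_m_closed[OF ring.is_monoid[OF subring_is_ring[OF assms(1)]] assms(2,3)] by simp

text \<open>This description of \<open>S\<^sup>-\<^sup>1M\<close> eliminates the inverses, and with them the dependence on the subring in
  which they are taken.\<close>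

lemma (in cring) fractions_in_iff:
  assumes K: "subring K R" and S: "S \<subseteq> Units (R\<lparr>carrier := K\<rparr>)" and M: "M \<subseteq> carrier R"
  shows "x \<in> fractions_in R K S M \<longleftrightarrow> x \<in> carrier R \<and> (\<exists>s\<in>S. s \<otimes> x \<in> M)"
proof -
  interpret K: ring "R\<lparr>carrier := K\<rparr>" by (rule subring_is_ring[OF K])
  let ?inv = "\<lambda>s. inv\<^bsub>R\<lparr>carrier := K\<rparr>\<^esub> s"
  have inv: "s \<in> carrier R" "?inv s \<in> carrier R" "s \<otimes> ?inv s = \<one>" "?inv s \<otimes> s = \<one>" if "s \<in> S" for s
    using that S K.Units_closed[of s] K.Units_inv_closed[of s] K.Units_r_inv[of s] K.Units_l_inv[of s]
      subringE(1)[OF K] by auto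
  show ?thesis
  proof
    assume "x \<in> fractions_in R K S M"
    then obtain s r where sr: "s \<in> S" "r \<in> M" "x = ?inv s \<otimes> r"
      unfolding fractions_in_def by blast
    then have "s \<otimes> x = r"
      using inv[of s] M by (simp add: m_assoc[symmetric] subset_iff)
    moreover have "x \<in> carrier R"
      using sr inv[of s] M by auto
    ultimately show "x \<in> carrier R \<and> (\<exists>s\<in>S. s \<otimes> x \<in> M)"
      using sr by blast
  next
    assume "x \<in> carrier R \<and> (\<exists>s\<in>S. s \<otimes> x \<in> M)"
    then obtain s where s: "x \<in> carrier R" "s \<in> S" "s \<otimes> x \<in> M" by blast
    then have "x = ?inv s \<otimes> (s \<otimes> x)"
      using inv[of s] by (simp add: m_assoc[symmetric])
    then show "x \<in> fractions_in R K S M"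
      using s unfolding fractions_in_def by blast
  qed
qed

lemma (in cring) subring_finsum_closed:
  assumes "subring K R" "finite I" "\<And>i. i \<in> I \<Longrightarrow> f i \<in> K"
  shows "(\<Oplus>i\<in>I. f i) \<in> K"
  using assms(2,3)
proof (induction I rule: finite_induct)
  case empty
  then show ?case using subringE(2)[OF assms(1)] by simp
next
  case (insert i I)
  then have "f \<in> insert i I \<rightarrow> carrier R"
    using subringE(1)[OF assms(1)] by blast
  then show ?case
    using insert subringE(7)[OF assms(1)] by (simp add: Pi_def)
qed

lemma (in cring) subring_seq_poly:
  assumes K: "\<And>i. subring (K i) R" and mono: "\<And>i j. i \<le> j \<Longrightarrow> K i \<subseteq> K j"
  shows "subring (seq_poly R K) (UP R)"
proof -
  interpret UP: UP_cring R "UP R" by unfold_locales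
  show ?thesis
  proof (rule UP.P.subringI)
    fix p q assume pq: "p \<in> seq_poly R K" "q \<in> seq_poly R K"
    then have [simp]: "p \<in> carrier (UP R)" "q \<in> carrier (UP R)"
      and coeff: "\<And>i. coeff (UP R) p i \<in> K i" "\<And>i. coeff (UP R) q i \<in> K i"
      unfolding seq_poly_def by auto
    show "p \<oplus>\<^bsub>UP R\<^esub> q \<in> seq_poly R K"
      unfolding seq_poly_def using coeff subringE(7)[OF K] by simp
    have "coeff (UP R) p i \<otimes> coeff (UP R) q (n - i) \<in> K n" if "i \<le> n" for i n
      using coeff(1)[of i] coeff(2)[of "n - i"] mono[of i n] mono[of "n - i" n] that subringE(6)[OF K]
      by (meson diff_le_self subset_iff)
    then have "coeff (UP R) (p \<otimes>\<^bsub>UP R\<^esub> q) n \<in> K n" for n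
      by (auto intro!: subring_finsum_closed[OF K])
    then show "p \<otimes>\<^bsub>UP R\<^esub> q \<in> seq_poly R K"
      unfolding seq_poly_def by simp
  next
    fix p assume "p \<in> seq_poly R K"
    then show "\<ominus>\<^bsub>UP R\<^esub> p \<in> seq_poly R K"
      unfolding seq_poly_def using subringE(5)[OF K] by simp
  qed (use subringE(2,3)[OF K] in \<open>auto simp: seq_poly_def\<close>)
qed

section \<open>Two nested sequences of subrings\<close>

locale nested_subring_sequences = cring A for A :: "('a, 'm) ring_scheme" (structure) +
  fixes R T :: "nat \<Rightarrow> 'a set"
  assumes subring_R: "subring (R i) A" and subring_T: "subring (T i) A"
    and R_Suc: "R i \<subseteq> R (Suc i)" and T_Suc: "T i \<subseteq> T (Suc i)"
    and R_subset_T: "R i \<subseteq> T i"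
begin

sublocale UP: UP_cring A "UP A"
  by unfold_locales

definition S :: "'a set" where
  "S = R 0 \<inter> Units (A\<lparr>carrier := T 0\<rparr>)"

lemma R_mono: "i \<le> j \<Longrightarrow> R i \<subseteq> R j" and T_mono: "i \<le> j \<Longrightarrow> T i \<subseteq> T j"
  using lift_Suc_mono_le[of R, OF R_Suc] lift_Suc_mono_le[of T, OF T_Suc] by blast+

lemma R_closed: "r \<in> R i \<Longrightarrow> r \<in> carrier A" and T_closed: "t \<in> T i \<Longrightarrow> t \<in> carrier A"
  using subringE(1)[OF subring_R] subringE(1)[OF subring_T] by blast+

lemma one_in_S: "\<one> \<in> S"
  unfolding S_def Int_iff Units_subring_iff[OF subring_T]
  using subringE(3)[OF subring_R] subringE(3)[OF subring_T] by (auto intro!: bexI[of _ \<one>])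

lemma S_mult: "s \<in> S \<Longrightarrow> s' \<in> S \<Longrightarrow> s \<otimes> s' \<in> S"
  unfolding S_def using subringE(6)[OF subring_R] Units_subring_mult[OF subring_T] by auto

lemma S_closed: "s \<in> S \<Longrightarrow> s \<in> carrier A"
  unfolding S_def using R_closed by blast

lemma S_in_R: "s \<in> S \<Longrightarrow> s \<in> R i"
  unfolding S_def using R_mono[of 0 i] by auto

lemma fractions_S_iff:
  "M \<subseteq> carrier A \<Longrightarrow> x \<in> fractions_in A (T 0) S M \<longleftrightarrow> x \<in> carrier A \<and> (\<exists>s\<in>S. s \<otimes> x \<in> M)"
  by (rule fractions_in_iff[OF subring_T]) (auto simp: S_def)

text \<open>Only one inclusion in \<open>T\<^sub>i = S\<^sup>-\<^sup>1R\<^sub>i\<close> carries information: inverses of elements of \<open>S\<close> lie in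
  \<open>T\<^sub>0 \<subseteq> T\<^sub>i\<close>.\<close>

lemma T_eq_fractions_iff: "T i = fractions_in A (T 0) S (R i) \<longleftrightarrow> (\<forall>t\<in>T i. \<exists>s\<in>S. s \<otimes> t \<in> R i)"
proof -
  have "t \<in> T i" if t: "t \<in> carrier A" and s: "s \<in> S" "s \<otimes> t \<in> R i" for s t
  proof -
    obtain v where v: "v \<in> T 0" "s \<otimes> v = \<one>"
      using s unfolding S_def Int_iff Units_subring_iff[OF subring_T] by blast
    then have "t = v \<otimes> (s \<otimes> t)"
      using t T_closed S_closed[OF s(1)] by (metis l_one m_assoc m_comm)
    then show ?thesis
      using v s R_subset_T T_mono[of 0 i] subringE(6)[OF subring_T, of v i "s \<otimes> t"] by auto
  qed
  moreover have "R i \<subseteq> carrier A" using R_closed by blast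
  ultimately show ?thesis
    using fractions_S_iff T_closed by (auto simp: set_eq_iff)
qed

lemma nilpotents_eq_fractions_if_reduced:
  assumes "reduced_ring (A\<lparr>carrier := T i\<rparr>)"
  shows "nilpotents (A\<lparr>carrier := T i\<rparr>) = fractions_in A (T 0) S (nilpotents (A\<lparr>carrier := R i\<rparr>))"
proof -
  have RT: "R i \<subseteq> carrier A" "T i \<subseteq> carrier A" using R_closed T_closed by blast+
  have T: "nilpotents (A\<lparr>carrier := T i\<rparr>) = {\<zero>}"
    using assms unfolding reduced_ring_def by simp
  then have R: "nilpotents (A\<lparr>carrier := R i\<rparr>) = {\<zero>}"
    using R_subset_T[of i] zero_nilpotent subringE(2)[OF subring_R]
    unfolding nilpotents_subring[OF RT(1)] nilpotents_subring[OF RT(2)] by blast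
  have "x = \<zero>" if x: "s \<in> S" "x \<in> carrier A" "s \<otimes> x = \<zero>" for s x
  proof -
    obtain v where "v \<in> T 0" "s \<otimes> v = \<one>"
      using x(1) unfolding S_def Int_iff Units_subring_iff[OF subring_T] by blast
    then have "x = v \<otimes> (s \<otimes> x)"
      using x(2) T_closed S_closed[OF x(1)] by (metis l_one m_assoc m_comm)
    then show ?thesis using x(3) T_closed[OF \<open>v \<in> T 0\<close>] by simp
  qed
  then have "x \<in> fractions_in A (T 0) S {\<zero>} \<longleftrightarrow> x = \<zero>" for x
    using one_in_S fractions_S_iff[of "{\<zero>}" x] r_null[OF one_closed] by blast
  then have "fractions_in A (T 0) S {\<zero>} = {\<zero>}" by blast
  then show ?thesis using T R by simp
qed

lemma subring_seq_poly_T: "subring (seq_poly A T) (UP A)"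
  by (rule subring_seq_poly[OF subring_T T_mono])

lemma seq_poly_R_subring: "subring (seq_poly A R) (seq_poly_ring A T)"
  unfolding seq_poly_ring_def
  by (rule UP.P.subring_of_subring[OF subring_seq_poly[OF subring_R R_mono] subring_seq_poly_T])
    (use R_subset_T in \<open>auto simp: seq_poly_def\<close>)

lemma monom_in_seq_poly: "t \<in> T i \<Longrightarrow> monom (UP A) t i \<in> seq_poly A T"
  unfolding seq_poly_def using T_closed subringE(2)[OF subring_T] by simp

text \<open>The whole use of units of \<open>T[x]\<close>: what is retained of an associating unit are the constraints on its
  individual coefficients.\<close>

lemma associated_seq_polyD:
  assumes "associated_subring (seq_poly A R) (seq_poly_ring A T)" and f: "f \<in> seq_poly A T"
  shows "\<exists>u\<in>carrier (UP A). (\<forall>i. coeff (UP A) (f \<otimes>\<^bsub>UP A\<^esub> u) i \<in> R i) \<and>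
    coeff (UP A) u 0 \<in> Units (A\<lparr>carrier := T 0\<rparr>) \<and>
    (\<forall>i>0. coeff (UP A) u i \<in> nilpotents (A\<lparr>carrier := T i\<rparr>))"
proof -
  obtain u where u: "u \<in> Units (seq_poly_ring A T)" "f \<otimes>\<^bsub>UP A\<^esub> u \<in> seq_poly A R"
    using assms unfolding associated_subring_def seq_poly_ring_def by auto
  then obtain v where v: "u \<in> seq_poly A T" "v \<in> seq_poly A T" "u \<otimes>\<^bsub>UP A\<^esub> v = \<one>\<^bsub>UP A\<^esub>"
    unfolding seq_poly_ring_def UP.P.Units_subring_iff[OF subring_seq_poly_T] by blast
  then have uv: "u \<in> carrier (UP A)" "v \<in> carrier (UP A)"
    and T: "\<And>i. coeff (UP A) u i \<in> T i" "\<And>i. coeff (UP A) v i \<in> T i"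
    unfolding seq_poly_def by auto
  have "coeff (UP A) u 0 \<otimes> coeff (UP A) v 0 = \<one>"
    using UP.coeff_mult[OF uv, of 0] v(3) uv by simp
  then have "coeff (UP A) u 0 \<in> Units (A\<lparr>carrier := T 0\<rparr>)"
    using T unfolding Units_subring_iff[OF subring_T] by blast
  moreover have "coeff (UP A) u i \<in> nilpotents (A\<lparr>carrier := T i\<rparr>)" if "0 < i" for i
    using UP.nilpotent_coeff_of_unit[OF uv v(3) that] T(1)[of i]
    by (simp add: nilpotents_subring[OF subringE(1)[OF subring_T]])
  moreover have "coeff (UP A) (f \<otimes>\<^bsub>UP A\<^esub> u) i \<in> R i" for i
    using u(2) unfolding seq_poly_def by simp
  ultimately show ?thesis using uv(1) by blast
qed

lemma associated_zero_if_associated_seq_poly: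
  assumes "associated_subring (seq_poly A R) (seq_poly_ring A T)"
  shows "associated_subring (R 0) (A\<lparr>carrier := T 0\<rparr>)"
  unfolding associated_subring_def
proof (intro conjI ballI)
  show "subring (R 0) (A\<lparr>carrier := T 0\<rparr>)"
    by (rule subring_of_subring[OF subring_R subring_T R_subset_T])
  fix t assume "t \<in> carrier (A\<lparr>carrier := T 0\<rparr>)"
  then have t: "t \<in> T 0" by simp
  obtain u where u: "u \<in> carrier (UP A)" "\<And>i. coeff (UP A) (monom (UP A) t 0 \<otimes>\<^bsub>UP A\<^esub> u) i \<in> R i"
    "coeff (UP A) u 0 \<in> Units (A\<lparr>carrier := T 0\<rparr>)"
    using associated_seq_polyD[OF assms monom_in_seq_poly[OF t]] by blast
  have "t \<otimes> coeff (UP A) u 0 \<in> R 0"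
    using u(1) u(2)[of 0] T_closed[OF t] by (simp add: UP.monom_mult_is_smult)
  then show "\<exists>u\<in>Units (A\<lparr>carrier := T 0\<rparr>). t \<otimes>\<^bsub>A\<lparr>carrier := T 0\<rparr>\<^esub> u \<in> R 0"
    using u(3) by auto
qed

text \<open>For \<open>t \<in> T\<^sub>i\<close> the element to be associated is \<open>1 + t x\<^sup>i\<close>. The coefficients of degree \<open>0\<close> and \<open>i\<close> of
  \<open>(1 + t x\<^sup>i) u\<close> are \<open>u\<^sub>0\<close> and \<open>u\<^sub>i + t u\<^sub>0\<close>: the constant term \<open>1\<close> forces \<open>u\<^sub>0 \<in> S\<close>, and the error term
  \<open>u\<^sub>i\<close> is nilpotent, so that the hypothesis on nilradicals supplies a denominator for it.\<close>

lemma denominator_if_associated_seq_poly: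
  assumes assoc: "associated_subring (seq_poly A R) (seq_poly_ring A T)"
    and nil: "nilpotents (A\<lparr>carrier := T i\<rparr>) \<subseteq> fractions_in A (T 0) S (nilpotents (A\<lparr>carrier := R i\<rparr>))"
    and i: "0 < i" and t: "t \<in> T i"
  shows "\<exists>s\<in>S. s \<otimes> t \<in> R i"
proof -
  let ?f = "\<one>\<^bsub>UP A\<^esub> \<oplus>\<^bsub>UP A\<^esub> monom (UP A) t i"
  have "?f \<in> seq_poly A T"
    using monom_in_seq_poly[OF t] subringE(3,7)[OF subring_seq_poly_T] by blast
  then obtain u where u: "u \<in> carrier (UP A)" "\<And>j. coeff (UP A) (?f \<otimes>\<^bsub>UP A\<^esub> u) j \<in> R j"
    "coeff (UP A) u 0 \<in> Units (A\<lparr>carrier := T 0\<rparr>)"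
    "\<And>j. 0 < j \<Longrightarrow> coeff (UP A) u j \<in> nilpotents (A\<lparr>carrier := T j\<rparr>)"
    using associated_seq_polyD[OF assoc] by meson
  let ?u = "coeff (UP A) u"
  have [simp]: "t \<in> carrier A" "\<And>j. ?u j \<in> carrier A"
    using T_closed[OF t] u(1) by auto
  have f: "?f \<otimes>\<^bsub>UP A\<^esub> u = u \<oplus>\<^bsub>UP A\<^esub> monom (UP A) t i \<otimes>\<^bsub>UP A\<^esub> u"
    using u(1) by (simp add: UP.P.l_distr)
  have "?u 0 \<in> R 0"
    using u(1) u(2)[of 0] i unfolding f by simp
  then have u0: "?u 0 \<in> S"
    using u(3) unfolding S_def by blast
  have ui: "?u i \<oplus> t \<otimes> ?u 0 \<in> R i"
    using u(1) u(2)[of i] UP.coeff_monom_mult[of t u i 0] unfolding f by (simp del: UP.coeff_mult)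
  have nR: "nilpotents (A\<lparr>carrier := R i\<rparr>) \<subseteq> R i"
    unfolding nilpotents_def by auto
  then have "nilpotents (A\<lparr>carrier := R i\<rparr>) \<subseteq> carrier A"
    using R_closed by blast
  then obtain s where s: "s \<in> S" "s \<otimes> ?u i \<in> R i"
    using u(4)[OF i] nil nR fractions_S_iff by blast
  have [simp]: "s \<in> carrier A" using S_closed[OF s(1)] .
  have "s \<otimes> (?u i \<oplus> t \<otimes> ?u 0) \<oplus> \<ominus> (s \<otimes> ?u i) \<in> R i"
    using s ui S_in_R subringE(5-7)[OF subring_R] by blast
  moreover have "s \<otimes> (?u i \<oplus> t \<otimes> ?u 0) \<oplus> \<ominus> (s \<otimes> ?u i) = (s \<otimes> ?u 0) \<otimes> t"
    by (simp add: r_distr m_ac a_ac r_neg2 r_neg1)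
  ultimately show ?thesis
    using S_mult[OF s(1) u0] by metis
qed

lemma common_denominator:
  assumes "finite I" "\<And>i. i \<in> I \<Longrightarrow> t i \<in> carrier A" "\<And>i. i \<in> I \<Longrightarrow> \<exists>s\<in>S. s \<otimes> t i \<in> R i"
  shows "\<exists>s\<in>S. \<forall>i\<in>I. s \<otimes> t i \<in> R i"
  using assms
proof (induction I rule: finite_induct)
  case empty
  then show ?case using one_in_S by blast
next
  case (insert i I)
  obtain s' where s': "s' \<in> S" "\<forall>i\<in>I. s' \<otimes> t i \<in> R i"
    using insert.IH insert.prems by blast
  moreover obtain s where "s \<in> S" "s \<otimes> t i \<in> R i"
    using insert.prems(2)[of i] by blast
  ultimately have s: "s \<in> S" "s \<otimes> t i \<in> R i" "s' \<in> S" "\<forall>i\<in>I. s' \<otimes> t i \<in> R i"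
    by blast+
  note [simp] = S_closed[OF s(1)] S_closed[OF s(3)]
  have "(s \<otimes> s') \<otimes> t j \<in> R j" if j: "j \<in> insert i I" for j
  proof -
    have "(s \<otimes> s') \<otimes> t j = s' \<otimes> (s \<otimes> t j)" "(s \<otimes> s') \<otimes> t j = s \<otimes> (s' \<otimes> t j)"
      using insert.prems(1)[OF j] by (simp_all add: m_ac)
    then show ?thesis
      using s j S_in_R[of s j] S_in_R[of s' j] subringE(6)[OF subring_R] by (metis insert_iff)
  qed
  then show ?case using S_mult s by blast
qed

text \<open>The associating unit can be taken constant: the unit of \<open>T\<^sub>0\<close> that brings the constant coefficient
  into \<open>R\<^sub>0\<close>, times a common denominator from \<open>S\<close> of the other coefficients.\<close>

lemma associated_seq_poly_if:
  assumes zero: "associated_subring (R 0) (A\<lparr>carrier := T 0\<rparr>)"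
    and frac: "\<And>i t. 0 < i \<Longrightarrow> t \<in> T i \<Longrightarrow> \<exists>s\<in>S. s \<otimes> t \<in> R i"
  shows "associated_subring (seq_poly A R) (seq_poly_ring A T)"
  unfolding associated_subring_def
proof (intro conjI ballI seq_poly_R_subring)
  fix f assume "f \<in> carrier (seq_poly_ring A T)"
  then have f: "f \<in> carrier (UP A)" "\<And>i. coeff (UP A) f i \<in> T i"
    unfolding seq_poly_ring_def seq_poly_def by auto
  let ?f = "coeff (UP A) f"
  obtain u where u: "u \<in> Units (A\<lparr>carrier := T 0\<rparr>)" "?f 0 \<otimes> u \<in> R 0"
    using zero f(2)[of 0] unfolding associated_subring_def by auto
  then have uT: "u \<in> T 0" unfolding Units_subring_iff[OF subring_T] by blast
  have fT: "?f i \<otimes> u \<in> T i" for i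
    using f(2)[of i] uT T_mono[of 0 i] subringE(6)[OF subring_T] by blast
  have "\<exists>s\<in>S. \<forall>i\<in>{..deg A f}. s \<otimes> (?f i \<otimes> u) \<in> R i"
  proof (rule common_denominator)
    fix i
    show "\<exists>s\<in>S. s \<otimes> (?f i \<otimes> u) \<in> R i"
    proof (cases "i = 0")
      case True
      then show ?thesis using one_in_S u(2) R_closed by (intro bexI[of _ \<one>]) auto
    next
      case False
      then show ?thesis using frac fT by blast
    qed
  qed (use fT T_closed in blast)+
  then obtain s where s: "s \<in> S" "\<And>i. i \<le> deg A f \<Longrightarrow> s \<otimes> (?f i \<otimes> u) \<in> R i"
    by auto
  define w where "w = s \<otimes> u"
  have "w \<in> Units (A\<lparr>carrier := T 0\<rparr>)"
    unfolding w_def using s(1) u(1) Units_subring_mult[OF subring_T] unfolding S_def by blast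
  then obtain v where w: "w \<in> T 0" "v \<in> T 0" "w \<otimes> v = \<one>"
    unfolding Units_subring_iff[OF subring_T] by blast
  have [simp]: "w \<in> carrier A" "v \<in> carrier A" "s \<in> carrier A" "u \<in> carrier A"
    using w T_closed S_closed[OF s(1)] uT by auto
  have "monom (UP A) w 0 \<otimes>\<^bsub>UP A\<^esub> monom (UP A) v 0 = \<one>\<^bsub>UP A\<^esub>"
    using w(3) UP.monom_mult[of w v 0 0] by simp
  then have "monom (UP A) w 0 \<in> Units (seq_poly_ring A T)"
    unfolding seq_poly_ring_def UP.P.Units_subring_iff[OF subring_seq_poly_T]
    using monom_in_seq_poly w by blast
  moreover have "coeff (UP A) (f \<otimes>\<^bsub>UP A\<^esub> monom (UP A) w 0) i \<in> R i" for i
  proof -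
    have eq: "coeff (UP A) (f \<otimes>\<^bsub>UP A\<^esub> monom (UP A) w 0) i = w \<otimes> ?f i"
      using f(1) UP.P.m_comm[OF f(1) UP.monom_closed[of w 0]]
      by (simp add: UP.monom_mult_is_smult del: UP.coeff_mult)
    show ?thesis
    proof (cases "i \<le> deg A f")
      case True
      have "w \<otimes> ?f i = s \<otimes> (?f i \<otimes> u)"
        unfolding w_def using f(1) by (simp add: m_ac)
      then show ?thesis using s(2)[OF True] eq by simp
    next
      case False
      then show ?thesis using f(1) eq UP.deg_aboveD[of f i] subringE(2)[OF subring_R] by simp
    qed
  qed
  ultimately show "\<exists>u\<in>Units (seq_poly_ring A T). f \<otimes>\<^bsub>seq_poly_ring A T\<^esub> u \<in> seq_poly A R"
    using f(1) by (intro bexI[of _ "monom (UP A) w 0"]) (auto simp: seq_poly_def seq_poly_ring_def)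
qed

end

theorem theorem4p1:
  fixes A :: "('a, 'm) ring_scheme" and R T :: "nat \<Rightarrow> 'a set" and S :: "'a set"
  assumes "cring A"
    and "\<And>i. subring (R i) A" and "\<And>i. subring (T i) A"
    and "\<And>i. R i \<subseteq> R (Suc i)" and "\<And>i. T i \<subseteq> T (Suc i)"
    and "\<And>i. R i \<subseteq> T i"
    and "S = R 0 \<inter> Units (A\<lparr>carrier := T 0\<rparr>)"
  shows
    "((\<forall>i\<ge>1. nilpotents (A\<lparr>carrier := T i\<rparr>) = fractions_in A (T 0) S (nilpotents (A\<lparr>carrier := R i\<rparr>)))
        \<longrightarrow> (associated_subring (seq_poly A R) (seq_poly_ring A T) \<longleftrightarrow>
              associated_subring (R 0) (A\<lparr>carrier := T 0\<rparr>) \<and>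
              (\<forall>i\<ge>1. T i = fractions_in A (T 0) S (R i))))
     \<and> ((\<forall>i. reduced_ring (A\<lparr>carrier := T i\<rparr>))
        \<longrightarrow> (\<forall>i\<ge>1. nilpotents (A\<lparr>carrier := T i\<rparr>) = fractions_in A (T 0) S (nilpotents (A\<lparr>carrier := R i\<rparr>))))"
proof -
  interpret nested_subring_sequences A R T
    using assms(1-6) by (simp add: nested_subring_sequences_def nested_subring_sequences_axioms_def)
  have S: "S = nested_subring_sequences.S A R T"
    using assms(7) S_def by simp
  show ?thesis
    unfolding S
  proof (intro conjI impI iffI allI)
    fix i :: nat
    assume nil: "\<forall>i\<ge>1. nilpotents (A\<lparr>carrier := T i\<rparr>) =
        fractions_in A (T 0) local.S (nilpotents (A\<lparr>carrier := R i\<rparr>))"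
      and assoc: "associated_subring (seq_poly A R) (seq_poly_ring A T)"
    show "associated_subring (R 0) (A\<lparr>carrier := T 0\<rparr>)"
      by (rule associated_zero_if_associated_seq_poly[OF assoc])
    assume "1 \<le> i"
    then show "T i = fractions_in A (T 0) local.S (R i)"
      unfolding T_eq_fractions_iff
      using denominator_if_associated_seq_poly[OF assoc, of i] nil by auto
  next
    assume "associated_subring (R 0) (A\<lparr>carrier := T 0\<rparr>) \<and>
        (\<forall>i\<ge>1. T i = fractions_in A (T 0) local.S (R i))"
    then show "associated_subring (seq_poly A R) (seq_poly_ring A T)"
      unfolding T_eq_fractions_iff by (intro associated_seq_poly_if) auto
  next
    fix i :: nat
    assume "\<forall>i. reduced_ring (A\<lparr>carrier := T i\<rparr>)"
    then show "nilpotents (A\<lparr>carrier := T i\<rparr>) =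
        fractions_in A (T 0) local.S (nilpotents (A\<lparr>carrier := R i\<rparr>))"
      by (simp add: nilpotents_eq_fractions_if_reduced)
  qed
qed

end
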